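(* Let $R$ be a $1$-dimensional Noetherian local ring. Let $x\in R$ be a parameter, let $u\in R$, and let $y=ux$. If the map $R/(x)\to R/(y)$ induced by multiplication by $u$ is injective, then $y$ is a parameter.
   Context: In a $1$-dimensional Noetherian local ring $(R,\mathfrak{m})$, a parameter is an element $x\in\mathfrak{m}$ forming a system of parameters, i.e. such that $(x)$ is $\mathfrak{m}$-primary. *)

theory Defs
  imports "HOL-Algebra.Ring_Divisibility" "HOL-Library.Extended_Nat"
begin

locale local_ring = cring R for R (structure) +
  fixes M :: "'a set"
  assumes maximal: "maximalideal M R"
    and unique_maximal: "maximalideal N R \<Longrightarrow> N = M"

text \<open>The length of a chain is the number of strict inclusions in it.\<close>

definition krull_dim :: "('a, 'b) ring_scheme \<Rightarrow> enat" where
  "krull_dim R = Sup {enat n | n. \<exists>P :: nat \<Rightarrow> 'a set.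
     (\<forall>i\<le>n. primeideal (P i) R) \<and> (\<forall>i<n. P i \<subset> P (Suc i))}"

definition radical :: "('a, 'b) ring_scheme \<Rightarrow> 'a set \<Rightarrow> 'a set" where
  "radical R I = {a \<in> carrier R. \<exists>n::nat. a [^]\<^bsub>R\<^esub> n \<in> I}"

locale primaryideal = ideal + cring +
  assumes I_notcarr: "carrier R \<noteq> I"
    and I_primary: "\<lbrakk>a \<in> carrier R; b \<in> carrier R; a \<otimes> b \<in> I\<rbrakk> \<Longrightarrow> a \<in> I \<or> b \<in> radical R I"

definition primary_to :: "('a, 'b) ring_scheme \<Rightarrow> 'a set \<Rightarrow> 'a set \<Rightarrow> bool" where
  "primary_to R M Q \<longleftrightarrow> primaryideal Q R \<and> radical R Q = M"

text \<open>Only meaningful for a one-dimensional local ring \<open>R\<close> with maximal ideal \<open>M\<close>, where a system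
  of parameters consists of a single element.\<close>

definition parameter :: "('a, 'b) ring_scheme \<Rightarrow> 'a set \<Rightarrow> 'a \<Rightarrow> bool" where
  "parameter R M x \<longleftrightarrow> x \<in> M \<and> primary_to R M (PIdl\<^bsub>R\<^esub> x)"

text \<open>The map \<open>R/I \<rightarrow> R/J\<close>, \<open>a + I \<mapsto> u a + J\<close>, on cosets. As in the library's definition of the
  multiplication of a quotient ring, the union is over all representatives of the argument;
  it is a single coset as soon as \<open>u I \<subseteq> J\<close>, see the lemmas below.\<close>

definition quot_mult :: "('a, 'b) ring_scheme \<Rightarrow> 'a set \<Rightarrow> 'a \<Rightarrow> 'a set \<Rightarrow> 'a set" where
  "quot_mult R J u A = (\<Union>a\<in>A. J +>\<^bsub>R\<^esub> (u \<otimes>\<^bsub>R\<^esub> a))"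

lemma (in ring) quot_mult_coset:
  assumes I: "ideal I R" and J: "ideal J R" and u: "u \<in> carrier R"
    and sub: "\<And>i. i \<in> I \<Longrightarrow> u \<otimes> i \<in> J" and a: "a \<in> carrier R"
  shows "quot_mult R J u (I +> a) = J +> (u \<otimes> a)"
proof -
  interpret I: ideal I R by fact
  interpret J: ideal J R by fact
  have eq: "J +> (u \<otimes> b) = J +> (u \<otimes> a)" if "b \<in> I +> a" for b
  proof -
    from that obtain i where i: "i \<in> I" and b: "b = i \<oplus> a"
      unfolding a_r_coset_def' by blast
    have "u \<otimes> b = u \<otimes> i \<oplus> u \<otimes> a"
      using i u a b by (simp add: r_distr)
    then have "u \<otimes> b \<in> J +> (u \<otimes> a)"
      using sub[OF i] unfolding a_r_coset_def' by blast
    then show ?thesis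
      using J.a_repr_independence' u a by (metis m_closed)
  qed
  have "a \<in> I +> a"
    using a I.a_rcos_self by blast
  with eq show ?thesis
    unfolding quot_mult_def by blast
qed

lemma (in cring) quot_mult_PIdl:
  assumes "x \<in> carrier R" "u \<in> carrier R" "a \<in> carrier R"
  shows "quot_mult R (PIdl (u \<otimes> x)) u (PIdl x +> a) = PIdl (u \<otimes> x) +> (u \<otimes> a)"
proof (rule quot_mult_coset)
  fix i assume "i \<in> PIdl x"
  then obtain r where "r \<in> carrier R" "i = r \<otimes> x"
    unfolding cgenideal_def by blast
  then show "u \<otimes> i \<in> PIdl (u \<otimes> x)"
    using assms unfolding cgenideal_def by (auto simp: m_lcomm)
qed (use assms in \<open>auto intro: cgenideal_ideal\<close>)

end

theory Submission
  imports Defs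
begin

text \<open>
  Write \<open>(0 : a)\<close> for the annihilator of \<open>a\<close>. Injectivity of \<open>R/(x) \<rightarrow> R/(ux)\<close> amounts to
  \<open>(0 : u) \<subseteq> (x)\<close>. If \<open>x\<close> is a nonzerodivisor this already gives \<open>(0 : u) = x (0 : u)\<close>, so
  \<open>(0 : u) = 0\<close> by Nakayama. In general the aim is that a power of \<open>x\<close> kills \<open>(0 : u)\<close>
  (\<open>annihilator_power_torsion\<close>); in other words, \<open>u\<close> becomes a nonzerodivisor once \<open>x\<close> is
  inverted.

  To see this, let \<open>L = (0 : ux)\<close> and let \<open>W \<subseteq> L\<close> consist of the elements killed by a power of
  \<open>x\<close>. As \<open>R\<close> is Noetherian, a single power kills \<open>W\<close>, and since \<open>(x)\<close> is \<open>M\<close>-primary, \<open>W\<close> has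
  finite length (\<open>finite_length_if_nilpotent\<close>). The hypothesis on \<open>u\<close> gives
  \<open>W \<inter> (0 : u) \<subseteq> x W\<close>. Counting lengths along multiplication by \<open>u\<close> and by \<open>x\<close> on \<open>W\<close>
  gives \<open>len W \<le> len (x W) + len (u W)\<close> and \<open>len W = len (x W) + len (0 : x)\<close>.
  As \<open>u W \<subseteq> (0 : x) \<subseteq> W\<close>, the ideals \<open>u W\<close> and \<open>(0 : x)\<close> are equal
  (\<open>kernel_eq_image_swap\<close>). For \<open>l \<in> L\<close>
  the element \<open>u l\<close> lies in \<open>(0 : x) = u W\<close>, hence \<open>l\<close> differs from an element of \<open>W\<close> by an
  element of \<open>(0 : u) \<subseteq> x L\<close>. So \<open>L = W + x L\<close>, and Nakayama yields \<open>L = W \<supseteq> (0 : u)\<close>.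

  Now let \<open>P\<close> be a prime containing \<open>ux\<close> and different from \<open>M\<close>. Then \<open>x \<notin> P\<close>, so \<open>u \<in> P\<close>. As
  the dimension is one, \<open>P\<close> is a minimal prime, and therefore \<open>u\<close> is nilpotent in the
  localization at \<open>P\<close> (\<open>minimal_prime_nilpotent\<close>); but in that localization \<open>x\<close> is invertible
  and \<open>u\<close> is thus a nonzerodivisor, which is absurd. Hence \<open>M\<close> is the only prime containing
  \<open>ux\<close>, and \<open>(ux)\<close> is \<open>M\<close>-primary.
\<close>

section \<open>Ideals attached to elements\<close>

context cring
begin

lemma ideal_if_closed:
  assumes "I \<subseteq> carrier R" "\<zero> \<in> I"
    and "\<And>a b. \<lbrakk>a \<in> I; b \<in> I\<rbrakk> \<Longrightarrow> a \<oplus> b \<in> I"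
    and mult: "\<And>r a. \<lbrakk>r \<in> carrier R; a \<in> I\<rbrakk> \<Longrightarrow> r \<otimes> a \<in> I"
  shows "ideal I R"
proof (rule idealI)
  show "subgroup I (add_monoid R)"
  proof (rule add.subgroupI)
    fix a assume a: "a \<in> I"
    then have "\<ominus> a = (\<ominus> \<one>) \<otimes> a"
      using assms(1) by (simp add: l_minus subset_iff)
    then show "\<ominus> a \<in> I"
      using mult[OF _ a, of "\<ominus> \<one>"] by simp
  qed (use assms in auto)
  show "a \<otimes> r \<in> I" if "a \<in> I" "r \<in> carrier R" for a r
    using that assms(1) mult[of r a] m_comm[of a r] by auto
qed (use mult ring_axioms in auto)

lemma ideal_subset: "ideal I R \<Longrightarrow> I \<subseteq> carrier R"
  by (auto dest: ideal.Icarr)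

lemma ideal_zero: "ideal I R \<Longrightarrow> \<zero> \<in> I"
  by (meson additive_subgroup.zero_closed ideal.axioms(1))

lemma ideal_add: "\<lbrakk>ideal I R; a \<in> I; b \<in> I\<rbrakk> \<Longrightarrow> a \<oplus> b \<in> I"
  by (meson additive_subgroup.a_closed ideal.axioms(1))

lemma ideal_neg: "\<lbrakk>ideal I R; a \<in> I\<rbrakk> \<Longrightarrow> \<ominus> a \<in> I"
  by (meson additive_subgroup.a_inv_closed ideal.axioms(1) abelian_group_axioms)

lemma ideal_minus: "\<lbrakk>ideal I R; a \<in> I; b \<in> I\<rbrakk> \<Longrightarrow> a \<ominus> b \<in> I"
  by (simp add: a_minus_def ideal_add ideal_neg)

lemma ideal_mult: "\<lbrakk>ideal I R; a \<in> I; r \<in> carrier R\<rbrakk> \<Longrightarrow> r \<otimes> a \<in> I"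
  by (rule ideal.I_l_closed)

definition colon :: "'a set \<Rightarrow> 'a \<Rightarrow> 'a set" where
  "colon J a = {r \<in> carrier R. r \<otimes> a \<in> J}"

lemma colon_ideal:
  assumes "ideal J R" "a \<in> carrier R"
  shows "ideal (colon J a) R"
  using assms unfolding colon_def
  by (intro ideal_if_closed) (auto simp: l_distr m_assoc ideal_zero ideal_add ideal_mult)

lemma scaled_ideal:
  assumes "ideal I R" "a \<in> carrier R"
  shows "ideal ((\<otimes>) a ` I) R"
proof (rule ideal_if_closed)
  note sub = ideal_subset[OF assms(1)]
  show "(\<otimes>) a ` I \<subseteq> carrier R"
    using sub assms by auto
  show "\<zero> \<in> (\<otimes>) a ` I"
    using ideal_zero[OF assms(1)] assms(2) by (metis image_eqI r_null)
  show "p \<oplus> q \<in> (\<otimes>) a ` I" if pq: "p \<in> (\<otimes>) a ` I" "q \<in> (\<otimes>) a ` I" for p q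
  proof -
    obtain i j where "i \<in> I" "j \<in> I" "p = a \<otimes> i" "q = a \<otimes> j"
      using pq by auto
    then have "p \<oplus> q = a \<otimes> (i \<oplus> j)" "i \<oplus> j \<in> I"
      using sub assms by (auto simp: r_distr subset_iff ideal_add)
    then show ?thesis by blast
  qed
  show "r \<otimes> p \<in> (\<otimes>) a ` I" if rp: "r \<in> carrier R" "p \<in> (\<otimes>) a ` I" for r p
  proof -
    obtain i where "i \<in> I" "p = a \<otimes> i"
      using rp by auto
    then have "r \<otimes> p = a \<otimes> (r \<otimes> i)" "r \<otimes> i \<in> I"
      using sub assms rp by (auto simp: m_lcomm subset_iff ideal_mult)
    then show ?thesis by blast
  qed
qed

lemma adjoin_ideal:
  assumes "ideal J R" "a \<in> carrier R"
  shows "ideal (J <+>\<^bsub>R\<^esub> PIdl a) R" "J \<subseteq> J <+>\<^bsub>R\<^esub> PIdl a" "a \<in> J <+>\<^bsub>R\<^esub> PIdl a"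
proof -
  show "ideal (J <+>\<^bsub>R\<^esub> PIdl a) R"
    by (intro add_ideals assms cgenideal_ideal)
  have p: "ideal (PIdl a) R" "a \<in> PIdl a"
    using assms(2) by (simp_all add: cgenideal_ideal cgenideal_self)
  show "J \<subseteq> J <+>\<^bsub>R\<^esub> PIdl a"
  proof
    fix j assume j: "j \<in> J"
    then have "j = j \<oplus> \<zero>"
      using ideal_subset[OF assms(1)] by auto
    then show "j \<in> J <+>\<^bsub>R\<^esub> PIdl a"
      using j ideal_zero[OF p(1)] unfolding set_add_def' by blast
  qed
  show "a \<in> J <+>\<^bsub>R\<^esub> PIdl a"
    using ideal_zero[OF assms(1)] p(2) assms(2) l_zero[of a] unfolding set_add_def' by force
qed

lemma adjoin_elem:
  assumes "b \<in> J <+>\<^bsub>R\<^esub> PIdl a"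
  obtains j r where "j \<in> J" "r \<in> carrier R" "b = j \<oplus> r \<otimes> a"
  using assms unfolding set_add_def' cgenideal_def by blast

section \<open>Length of an ideal\<close>

text \<open>Lengths are handled through functions that increase strictly along inclusions of subideals
  of \<open>I\<close>. Such a function with natural values bounds the length of every chain of subideals, and
  the length of a composition series is the least value that it can take at \<open>I\<close>. With this
  description an upper bound for a length amounts to exhibiting one such function, and no chains
  have to be manipulated.\<close>

definition strict_rank :: "'a set \<Rightarrow> ('a set \<Rightarrow> nat) \<Rightarrow> bool" where
  "strict_rank I f \<longleftrightarrow>
     (\<forall>A B. ideal A R \<longrightarrow> ideal B R \<longrightarrow> A \<subset> B \<longrightarrow> B \<subseteq> I \<longrightarrow> f A < f B)"

definition finite_length :: "'a set \<Rightarrow> bool" where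
  "finite_length I \<longleftrightarrow> (\<exists>f. strict_rank I f)"

text \<open>Meaningful only if \<open>finite_length I\<close> holds.\<close>

definition len :: "'a set \<Rightarrow> nat" where
  "len I = (LEAST n. \<exists>f. strict_rank I f \<and> f I = n)"

lemma strict_rank_subset: "\<lbrakk>strict_rank I f; J \<subseteq> I\<rbrakk> \<Longrightarrow> strict_rank J f"
  unfolding strict_rank_def by (meson subset_trans)

lemma finite_length_subset: "\<lbrakk>finite_length I; J \<subseteq> I\<rbrakk> \<Longrightarrow> finite_length J"
  unfolding finite_length_def by (meson strict_rank_subset)

lemma len_le: "strict_rank I f \<Longrightarrow> len I \<le> f I"
  unfolding len_def by (rule Least_le) blast

lemma len_attained:
  assumes "finite_length I"
  obtains f where "strict_rank I f" "f I = len I"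
proof -
  have "\<exists>n f. strict_rank I f \<and> f I = n"
    using assms unfolding finite_length_def by blast
  then have "\<exists>f. strict_rank I f \<and> f I = len I"
    unfolding len_def by (rule LeastI_ex)
  then show ?thesis using that by blast
qed

text \<open>A rank function that is optimal at \<open>B\<close> also bounds the length of \<open>A\<close> from above.\<close>

lemma len_strict_mono:
  assumes "finite_length B" "ideal A R" "ideal B R" "A \<subset> B"
  shows "len A < len B"
proof -
  obtain f where f: "strict_rank B f" "f B = len B"
    using len_attained[OF assms(1)] .
  have "len A \<le> f A"
    using assms(4) by (intro len_le strict_rank_subset[OF f(1)]) auto
  also have "f A < f B"
    using f(1) assms unfolding strict_rank_def by blast
  finally show ?thesis using f(2) by simp
qed

lemma len_mono:
  assumes "finite_length B" "ideal A R" "ideal B R" "A \<subseteq> B"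
  shows "len A \<le> len B"
  using len_strict_mono[OF assms(1-3)] assms(4) by (cases "A = B") (auto simp: psubset_eq)

text \<open>A strict inclusion \<open>A \<subset> B\<close> stays strict after multiplication by \<open>a\<close> or after intersection
  with the kernel of this multiplication.\<close>

lemma len_le_image_kernel:
  assumes I: "ideal I R" "finite_length I" and a: "a \<in> carrier R"
    and fin: "finite_length ((\<otimes>) a ` I)"
  shows "len I \<le> len ((\<otimes>) a ` I) + len (I \<inter> colon {\<zero>} a)"
proof -
  let ?k = "colon {\<zero>} a"
  have k: "ideal ?k R"
    using a by (intro colon_ideal zeroideal)
  have "strict_rank I (\<lambda>A. len ((\<otimes>) a ` A) + len (A \<inter> ?k))"
    unfolding strict_rank_def
  proof (intro allI impI)
    fix A B assume A: "ideal A R" and B: "ideal B R" and AB: "A \<subset> B" and BI: "B \<subseteq> I"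
    have sub: "(\<otimes>) a ` A \<subseteq> (\<otimes>) a ` B" "A \<inter> ?k \<subseteq> B \<inter> ?k"
      using AB by auto
    have fl: "finite_length ((\<otimes>) a ` B)" "finite_length (B \<inter> ?k)"
      using BI by (auto intro: finite_length_subset[OF fin] finite_length_subset[OF I(2)])
    have ids: "ideal ((\<otimes>) a ` A) R" "ideal ((\<otimes>) a ` B) R" "ideal (A \<inter> ?k) R" "ideal (B \<inter> ?k) R"
      using A B a k by (auto intro: scaled_ideal i_intersect)
    have "(\<otimes>) a ` A \<noteq> (\<otimes>) a ` B \<or> A \<inter> ?k \<noteq> B \<inter> ?k"
    proof (rule ccontr)
      assume "\<not> ?thesis"
      then have eq: "(\<otimes>) a ` A = (\<otimes>) a ` B" "A \<inter> ?k = B \<inter> ?k" by auto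
      have "B \<subseteq> A"
      proof
        fix b assume b: "b \<in> B"
        then obtain c where c: "c \<in> A" "a \<otimes> b = a \<otimes> c"
          using eq(1) by blast
        have car: "b \<in> carrier R" "c \<in> carrier R"
          using b c A B ideal_subset by auto
        have "(b \<ominus> c) \<otimes> a = a \<otimes> b \<ominus> a \<otimes> c"
          using car a by algebra
        also have "\<dots> = \<zero>"
          using c car a by (simp add: r_neg a_minus_def)
        finally have "b \<ominus> c \<in> ?k"
          using car unfolding colon_def by simp
        moreover have "b \<ominus> c \<in> B"
          using b c AB B by (auto intro: ideal_minus)
        ultimately have "b \<ominus> c \<in> A"
          using eq(2) by blast
        then have "(b \<ominus> c) \<oplus> c \<in> A"
          using c A by (simp add: ideal_add)
        moreover have "(b \<ominus> c) \<oplus> c = b"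
          using car by algebra
        ultimately show "b \<in> A" by simp
      qed
      with AB show False by blast
    qed
    then show "len ((\<otimes>) a ` A) + len (A \<inter> ?k) < len ((\<otimes>) a ` B) + len (B \<inter> ?k)"
    proof
      assume "(\<otimes>) a ` A \<noteq> (\<otimes>) a ` B"
      then have "len ((\<otimes>) a ` A) < len ((\<otimes>) a ` B)"
        using sub(1) by (intro len_strict_mono fl ids psubsetI)
      then show ?thesis
        using len_mono[OF fl(2) ids(3,4) sub(2)] by simp
    next
      assume "A \<inter> ?k \<noteq> B \<inter> ?k"
      then have "len (A \<inter> ?k) < len (B \<inter> ?k)"
        using sub(2) by (intro len_strict_mono fl ids psubsetI)
      then show ?thesis
        using len_mono[OF fl(1) ids(1,2) sub(1)] by simp
    qed
  qed
  then show ?thesis by (rule len_le)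
qed

text \<open>Taking preimages under multiplication by \<open>a\<close> embeds the subideals of \<open>a I\<close> into those
  subideals of \<open>I\<close> that contain the kernel.\<close>

lemma image_kernel_le_len:
  assumes I: "ideal I R" "finite_length I" and a: "a \<in> carrier R"
  shows "finite_length ((\<otimes>) a ` I)"
    and "len ((\<otimes>) a ` I) + len (I \<inter> colon {\<zero>} a) \<le> len I"
proof -
  let ?K = "I \<inter> colon {\<zero>} a"
  have K: "ideal ?K R"
    using I a by (intro i_intersect colon_ideal zeroideal)
  have pre: "ideal (I \<inter> colon A a) R" "finite_length (I \<inter> colon A a)"
    "len ?K \<le> len (I \<inter> colon A a)" if "ideal A R" for A
  proof -
    show 1: "ideal (I \<inter> colon A a) R"
      using I a that by (intro i_intersect colon_ideal)
    show 2: "finite_length (I \<inter> colon A a)"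
      by (rule finite_length_subset[OF I(2)]) auto
    have "?K \<subseteq> I \<inter> colon A a"
      using ideal_zero[OF that] by (auto simp: colon_def)
    then show "len ?K \<le> len (I \<inter> colon A a)"
      by (rule len_mono[OF 2 K 1])
  qed
  have rank: "strict_rank ((\<otimes>) a ` I) (\<lambda>A. len (I \<inter> colon A a) - len ?K)"
    unfolding strict_rank_def
  proof (intro allI impI)
    fix A B assume A: "ideal A R" and B: "ideal B R" and AB: "A \<subset> B" and BI: "B \<subseteq> (\<otimes>) a ` I"
    obtain b where b: "b \<in> B" "b \<notin> A"
      using AB by blast
    then obtain i where i: "i \<in> I" "b = a \<otimes> i"
      using BI by blast
    then have "i \<in> I \<inter> colon B a" "i \<notin> I \<inter> colon A a"
      using b a ideal_subset[OF I(1)] by (auto simp: colon_def m_comm subset_iff)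
    moreover have "I \<inter> colon A a \<subseteq> I \<inter> colon B a"
      using AB by (auto simp: colon_def)
    ultimately have "len (I \<inter> colon A a) < len (I \<inter> colon B a)"
      using pre A B by (intro len_strict_mono) auto
    then show "len (I \<inter> colon A a) - len ?K < len (I \<inter> colon B a) - len ?K"
      using pre(3)[OF A] by simp
  qed
  then show "finite_length ((\<otimes>) a ` I)"
    unfolding finite_length_def by blast
  have "I \<inter> colon ((\<otimes>) a ` I) a = I"
    using a ideal_subset[OF I(1)] by (auto simp: colon_def m_comm subset_iff)
  then have "len ((\<otimes>) a ` I) \<le> len I - len ?K"
    using len_le[OF rank] by simp
  moreover have "len ?K \<le> len I"
    using len_mono[OF I(2) K I(1)] by auto
  ultimately show "len ((\<otimes>) a ` I) + len ?K \<le> len I"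
    by simp
qed

text \<open>When \<open>u x\<close> kills \<open>W\<close>, multiplications by \<open>x\<close> and \<open>u\<close> in turn form a two-periodic complex on
  \<open>W\<close>. Exactness at one of the two places forces exactness at the other, because
  \<open>len (u W) \<ge> len W - len (W \<inter> (0 : u)) \<ge> len W - len (x W) \<ge> len (W \<inter> (0 : x))\<close>.\<close>

lemma kernel_eq_image_swap:
  assumes W: "ideal W R" "finite_length W" and x: "x \<in> carrier R" and u: "u \<in> carrier R"
    and exact: "W \<inter> colon {\<zero>} u \<subseteq> (\<otimes>) x ` W"
    and complex: "(\<otimes>) u ` W \<subseteq> W \<inter> colon {\<zero>} x"
  shows "(\<otimes>) u ` W = W \<inter> colon {\<zero>} x"
proof (rule ccontr)
  assume "\<not> ?thesis"
  have "finite_length (W \<inter> colon {\<zero>} x)" "ideal (W \<inter> colon {\<zero>} x) R"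
    using W x by (auto intro: finite_length_subset[OF W(2)] i_intersect colon_ideal zeroideal)
  with \<open>\<not> ?thesis\<close> complex have "len ((\<otimes>) u ` W) < len (W \<inter> colon {\<zero>} x)"
    using W u by (intro len_strict_mono scaled_ideal) auto
  moreover have "len W \<le> len ((\<otimes>) u ` W) + len (W \<inter> colon {\<zero>} u)"
    using W u by (intro len_le_image_kernel image_kernel_le_len)
  moreover have "len (W \<inter> colon {\<zero>} u) \<le> len ((\<otimes>) x ` W)"
    using W x u exact
    by (intro len_mono image_kernel_le_len scaled_ideal i_intersect colon_ideal zeroideal)
  moreover have "len ((\<otimes>) x ` W) + len (W \<inter> colon {\<zero>} x) \<le> len W"
    using W x by (intro image_kernel_le_len)
  ultimately show False by simp
qed

end

section \<open>Noetherian rings\<close>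

lemma (in noetherian_ring) exists_maximal_ideal_in:
  assumes "S \<noteq> {}" "\<And>I. I \<in> S \<Longrightarrow> ideal I R"
  obtains J where "J \<in> S" "\<And>I. \<lbrakk>I \<in> S; J \<subseteq> I\<rbrakk> \<Longrightarrow> I = J"
proof -
  have "\<exists>J\<in>S. \<forall>I\<in>S. J \<subseteq> I \<longrightarrow> I = J"
  proof (rule subset_Zorn)
    fix C assume C: "subset.chain S C"
    show "\<exists>U\<in>S. \<forall>X\<in>C. X \<subseteq> U"
    proof (cases "C = {}")
      case True
      then show ?thesis using assms(1) by blast
    next
      case False
      have "subset.chain {I. ideal I R} C"
        using C assms(2) unfolding pred_on.chain_def by blast
      then have "\<Union>C \<in> C"
        by (rule ideal_chain_is_trivial[OF False])
      then show ?thesis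
        using C by (intro bexI[of _ "\<Union>C"]) (auto simp: pred_on.chain_def)
    qed
  qed
  then show ?thesis using that by blast
qed

locale noetherian_cring = noetherian_ring + cring
begin

text \<open>An ideal that is maximal among those containing \<open>I\<close> and missing \<open>S\<close> is prime.\<close>

lemma exists_prime_avoiding:
  assumes I: "ideal I R" and disj: "I \<inter> S = {}"
    and S: "S \<subseteq> carrier R" "\<one> \<in> S" "\<And>s t. \<lbrakk>s \<in> S; t \<in> S\<rbrakk> \<Longrightarrow> s \<otimes> t \<in> S"
  obtains P where "primeideal P R" "I \<subseteq> P" "P \<inter> S = {}"
proof -
  define F where "F = {J. ideal J R \<and> I \<subseteq> J \<and> J \<inter> S = {}}"
  obtain P where P: "P \<in> F" and max: "\<And>J. \<lbrakk>J \<in> F; P \<subseteq> J\<rbrakk> \<Longrightarrow> J = P"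
    by (rule exists_maximal_ideal_in[of F]) (use I disj in \<open>auto simp: F_def\<close>)
  have idP: "ideal P R" and IP: "I \<subseteq> P" and PS: "P \<inter> S = {}"
    using P by (auto simp: F_def)
  have meets: "\<exists>j\<in>P. \<exists>r\<in>carrier R. j \<oplus> r \<otimes> a \<in> S" if a: "a \<in> carrier R" "a \<notin> P" for a
  proof -
    have "P <+>\<^bsub>R\<^esub> PIdl a \<notin> F"
      using max[of "P <+>\<^bsub>R\<^esub> PIdl a"] adjoin_ideal[OF idP a(1)] a(2) by blast
    then have "(P <+>\<^bsub>R\<^esub> PIdl a) \<inter> S \<noteq> {}"
      using adjoin_ideal[OF idP a(1)] IP by (auto simp: F_def)
    then show ?thesis
      by (metis adjoin_elem disjoint_iff)
  qed
  have "primeideal P R"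
  proof (rule primeidealI[OF idP is_cring])
    show "carrier R \<noteq> P"
      using PS S by blast
    fix a b assume ab: "a \<in> carrier R" "b \<in> carrier R" "a \<otimes> b \<in> P"
    show "a \<in> P \<or> b \<in> P"
    proof (rule ccontr)
      assume "\<not> ?thesis"
      then obtain i r j s where *: "i \<in> P" "r \<in> carrier R" "i \<oplus> r \<otimes> a \<in> S"
        "j \<in> P" "s \<in> carrier R" "j \<oplus> s \<otimes> b \<in> S"
        using meets ab by meson
      have car: "i \<in> carrier R" "j \<in> carrier R"
        using * ideal_subset[OF idP] by auto
      have "(i \<oplus> r \<otimes> a) \<otimes> (j \<oplus> s \<otimes> b) = (j \<oplus> s \<otimes> b) \<otimes> i \<oplus> ((r \<otimes> a) \<otimes> j \<oplus> (r \<otimes> s) \<otimes> (a \<otimes> b))"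
        using car * ab by algebra
      also have "\<dots> \<in> P"
        using car * ab by (simp add: ideal_add[OF idP] ideal_mult[OF idP])
      finally show False
        using S(3)[OF *(3) *(6)] PS by blast
    qed
  qed
  then show ?thesis
    using that IP PS by blast
qed

text \<open>In the absence of such a relation the multiplicative set of all \<open>s \<otimes> u\<^sup>n\<close> with \<open>s \<notin> P\<close> would avoid \<open>0\<close>, and a prime
  missing it would lie strictly below \<open>P\<close>.\<close>

lemma minimal_prime_nilpotent:
  assumes P: "primeideal P R" and min: "\<And>Q. primeideal Q R \<Longrightarrow> \<not> Q \<subset> P" and u: "u \<in> P"
  obtains s and n :: nat where "s \<in> carrier R" "s \<notin> P" "s \<otimes> u [^] n = \<zero>"
proof -
  interpret P: primeideal P R by fact
  have uc: "u \<in> carrier R" using u by auto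
  define S where "S = {s \<otimes> u [^] n | s (n::nat). s \<in> carrier R \<and> s \<notin> P}"
  have one: "\<one> \<notin> P"
    using P.I_notcarr P.one_imp_carrier by blast
  have "\<zero> \<in> S"
  proof (rule ccontr)
    assume "\<zero> \<notin> S"
    have mem: "s \<otimes> u [^] n \<in> S" if "s \<in> carrier R" "s \<notin> P" for s and n :: nat
      using that unfolding S_def by blast
    obtain Q where Q: "primeideal Q R" "Q \<inter> S = {}"
    proof (rule exists_prime_avoiding[of "{\<zero>}" S])
      show "ideal {\<zero>} R" by (rule zeroideal)
      show "{\<zero>} \<inter> S = {}" using \<open>\<zero> \<notin> S\<close> by simp
      show "S \<subseteq> carrier R" using uc by (auto simp: S_def)
      show "\<one> \<in> S" using mem[OF _ one, of 0] by simp
      fix a b assume "a \<in> S" "b \<in> S"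
      then obtain s t and m n :: nat where st: "s \<in> carrier R" "s \<notin> P" "t \<in> carrier R" "t \<notin> P"
        and ab: "a = s \<otimes> u [^] m" "b = t \<otimes> u [^] n"
        unfolding S_def by blast
      have "a \<otimes> b = (s \<otimes> t) \<otimes> (u [^] m \<otimes> u [^] n)"
        unfolding ab using st uc by (simp add: m_ac)
      then have "a \<otimes> b = (s \<otimes> t) \<otimes> u [^] (m + n)"
        using uc by (simp add: nat_pow_mult)
      moreover have "s \<otimes> t \<notin> P"
        using P.I_prime st by blast
      ultimately show "a \<otimes> b \<in> S"
        using mem[of "s \<otimes> t"] st by simp
    qed
    have "Q \<subseteq> P"
    proof
      fix q assume q: "q \<in> Q"
      then have "q \<in> carrier R"
        using primeideal.axioms(1)[OF Q(1)] ideal_subset by blast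
      then show "q \<in> P"
        using mem[of q 0] q Q(2) by auto
    qed
    moreover have "u \<notin> Q"
      using mem[OF _ one, of 1] uc Q(2) by auto
    ultimately show False
      using min[OF Q(1)] u by blast
  qed
  then show ?thesis
    unfolding S_def using that by auto
qed

text \<open>Noetherian induction on the subideals \<open>J\<close> of finite length: if \<open>J \<noteq> W\<close>, then \<open>W / J\<close> has a
  nonzero element killed by \<open>M\<close>, and adjoining it to \<open>J\<close> raises the length by at most one because
  it spans a simple module over \<open>R\<close>.\<close>

lemma finite_length_if_nilpotent:
  assumes M: "maximalideal M R" and W: "ideal W R"
    and nil: "\<And>m. m \<in> M \<Longrightarrow> \<exists>k::nat. \<forall>w\<in>W. m [^] k \<otimes> w = \<zero>"
  shows "finite_length W"
proof -
  interpret M: maximalideal M R by fact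
  note Wc = ideal_subset[OF W]
  define F where "F = {J. ideal J R \<and> J \<subseteq> W \<and> finite_length J}"
  have "finite_length {\<zero>}"
    unfolding finite_length_def strict_rank_def using ideal_zero by blast
  then have "{\<zero>} \<in> F"
    using zeroideal ideal_zero[OF W] by (auto simp: F_def)
  then obtain J where "J \<in> F" and max: "\<And>I. \<lbrakk>I \<in> F; J \<subseteq> I\<rbrakk> \<Longrightarrow> I = J"
    by (rule_tac exists_maximal_ideal_in[of F]) (auto simp: F_def)
  then have J: "ideal J R" "J \<subseteq> W" "finite_length J"
    by (auto simp: F_def)
  have "J = W"
  proof (rule ccontr)
    assume "J \<noteq> W"
    \<comment> \<open>A maximal colon ideal \<open>(J : w)\<close> contains \<open>M\<close>: if \<open>m w \<notin> J\<close>, then \<open>(J : m w) = (J : w)\<close>,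
      and so no power of \<open>m\<close> could send \<open>w\<close> into \<open>J\<close>.\<close>
    obtain T where "T \<in> colon J ` (W - J)"
      and Tmax: "\<And>I. \<lbrakk>I \<in> colon J ` (W - J); T \<subseteq> I\<rbrakk> \<Longrightarrow> I = T"
      by (rule exists_maximal_ideal_in[of "colon J ` (W - J)"])
        (use \<open>J \<noteq> W\<close> J Wc in \<open>auto intro: colon_ideal\<close>)
    then obtain w where w: "w \<in> W" "w \<notin> J" and T: "T = colon J w"
      by blast
    have wc: "w \<in> carrier R" using w Wc by blast
    have kills: "m \<otimes> w \<in> J" if m: "m \<in> M" for m
    proof (rule ccontr)
      assume notin: "m \<otimes> w \<notin> J"
      have mc: "m \<in> carrier R" using m by auto
      have "colon J w \<subseteq> colon J (m \<otimes> w)"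
      proof
        fix r assume "r \<in> colon J w"
        then have r: "r \<in> carrier R" "r \<otimes> w \<in> J" by (auto simp: colon_def)
        have "r \<otimes> (m \<otimes> w) = m \<otimes> (r \<otimes> w)"
          using r mc wc by (simp add: m_ac)
        then show "r \<in> colon J (m \<otimes> w)"
          using r mc J(1) by (simp add: colon_def ideal_mult)
      qed
      moreover have "m \<otimes> w \<in> W - J"
        using notin w mc W by (simp add: ideal_mult)
      ultimately have eq: "colon J (m \<otimes> w) = colon J w"
        using Tmax T by blast
      have never: "m [^] i \<notin> colon J w" for i :: nat
      proof (induction i)
        case 0
        then show ?case using w wc by (simp add: colon_def)
      next
        case (Suc i)
        have "m [^] Suc i \<otimes> w = m [^] i \<otimes> (m \<otimes> w)"
          using mc wc by (simp add: m_assoc)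
        moreover have "m [^] i \<otimes> (m \<otimes> w) \<notin> J"
          using Suc mc eq by (auto simp: colon_def)
        ultimately show ?case
          unfolding colon_def by auto
      qed
      obtain k :: nat where "m [^] k \<otimes> w = \<zero>"
        using nil[OF m] w by blast
      then show False
        using never[of k] mc ideal_zero[OF J(1)] by (simp add: colon_def)
    qed
    let ?J = "J <+>\<^bsub>R\<^esub> PIdl w"
    have "strict_rank ?J (\<lambda>A. len (A \<inter> J) + (if A \<subseteq> J then 0 else 1))"
      unfolding strict_rank_def
    proof (intro allI impI)
      fix A B assume A: "ideal A R" and B: "ideal B R" and AB: "A \<subset> B" and BJ: "B \<subseteq> ?J"
      have fl: "finite_length (B \<inter> J)"
        by (rule finite_length_subset[OF J(3)]) auto
      have ids: "ideal (A \<inter> J) R" "ideal (B \<inter> J) R"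
        using A B J by (auto intro: i_intersect)
      show "len (A \<inter> J) + (if A \<subseteq> J then 0 else 1) < len (B \<inter> J) + (if B \<subseteq> J then 0 else 1)"
      proof (cases "A \<inter> J = B \<inter> J")
        case False
        then have "len (A \<inter> J) < len (B \<inter> J)"
          using AB by (intro len_strict_mono fl ids) auto
        then show ?thesis using AB by auto
      next
        case True
        then have "\<not> B \<subseteq> J" using AB by blast
        moreover have "A \<subseteq> J"
        proof (rule ccontr)
          assume "\<not> A \<subseteq> J"
          then obtain a where a: "a \<in> A" "a \<notin> J" by blast
          then obtain j r where jr: "j \<in> J" "r \<in> carrier R" "a = j \<oplus> r \<otimes> w"
            using AB BJ by (metis adjoin_elem psubsetE subsetD)
          have "r \<notin> M"
            using kills[of r] jr a J(1) ideal_add by blast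
          then have "M <+>\<^bsub>R\<^esub> PIdl r = carrier R"
            using M.I_maximal[of "M <+>\<^bsub>R\<^esub> PIdl r"] adjoin_ideal[OF M.is_ideal jr(2)] ideal_subset by blast
          then obtain m s where ms: "m \<in> M" "s \<in> carrier R" "\<one> = m \<oplus> s \<otimes> r"
            by (metis adjoin_elem one_closed)
          have car: "m \<in> carrier R" "j \<in> carrier R" "a \<in> carrier R"
            using ms jr a J(1) A ideal_subset by auto
          have "B \<subseteq> A"
          proof
            fix b assume b: "b \<in> B"
            then obtain i t where it: "i \<in> J" "t \<in> carrier R" "b = i \<oplus> t \<otimes> w"
              using BJ by (metis adjoin_elem subsetD)
            have ic: "i \<in> carrier R" and bc: "b \<in> carrier R"
              using it b J(1) B ideal_subset by auto
            \<comment> \<open>Modulo \<open>J\<close>, the relation \<open>m w \<in> J\<close> gives \<open>w \<equiv> s r w \<equiv> s a\<close> and hence \<open>b \<equiv> t s a\<close>.\<close>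
            have "b \<ominus> (t \<otimes> s) \<otimes> a = i \<oplus> t \<otimes> (\<one> \<otimes> w) \<ominus> (t \<otimes> s) \<otimes> (j \<oplus> r \<otimes> w)"
              using it jr wc by simp
            also have "\<dots> = (i \<oplus> t \<otimes> (m \<otimes> w)) \<ominus> (t \<otimes> s) \<otimes> j"
              unfolding ms(3) using it(2) jr(2) ms(2) car ic wc by algebra
            also have "\<dots> \<in> J"
              using it(1,2) jr(1) ms(1,2) kills by (simp add: ideal_minus ideal_add ideal_mult J(1))
            finally have "b \<ominus> (t \<otimes> s) \<otimes> a \<in> J" .
            moreover have "b \<ominus> (t \<otimes> s) \<otimes> a \<in> B"
              using b a(1) AB it(2) ms(2) by (simp add: ideal_minus ideal_mult B psubset_eq subset_iff)
            ultimately have "b \<ominus> (t \<otimes> s) \<otimes> a \<in> A"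
              using True by blast
            then have "(b \<ominus> (t \<otimes> s) \<otimes> a) \<oplus> (t \<otimes> s) \<otimes> a \<in> A"
              using a(1) it(2) ms(2) by (simp add: ideal_add ideal_mult A)
            moreover have "(b \<ominus> (t \<otimes> s) \<otimes> a) \<oplus> (t \<otimes> s) \<otimes> a = b"
              using it(2) ms(2) car bc by algebra
            ultimately show "b \<in> A" by simp
          qed
          with AB show False by blast
        qed
        ultimately show ?thesis using True by simp
      qed
    qed
    then have "finite_length ?J"
      unfolding finite_length_def by blast
    moreover have "?J \<subseteq> W"
    proof
      fix b assume "b \<in> ?J"
      then obtain j r where "j \<in> J" "r \<in> carrier R" "b = j \<oplus> r \<otimes> w"
        by (rule adjoin_elem)
      then show "b \<in> W"
        using J(2) w W by (auto intro: ideal_add ideal_mult)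
    qed
    ultimately have "?J = J"
      using adjoin_ideal[OF J(1) wc] by (intro max) (auto simp: F_def)
    then show False
      using adjoin_ideal(3)[OF J(1) wc] w by blast
  qed
  then show ?thesis using J by simp
qed

end

section \<open>Noetherian local rings\<close>

locale noetherian_local_ring = local_ring R M + noetherian_cring R for R (structure) and M
begin

sublocale M: maximalideal M R
  by (rule maximal)

lemma proper_ideal_subset:
  assumes "ideal I R" "\<one> \<notin> I"
  shows "I \<subseteq> M"
proof -
  define F where "F = {J. ideal J R \<and> I \<subseteq> J \<and> \<one> \<notin> J}"
  obtain N where "N \<in> F" and max: "\<And>J. \<lbrakk>J \<in> F; N \<subseteq> J\<rbrakk> \<Longrightarrow> J = N"
    by (rule exists_maximal_ideal_in[of F]) (use assms in \<open>auto simp: F_def\<close>)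
  then have N: "ideal N R" "I \<subseteq> N" "\<one> \<notin> N"
    by (auto simp: F_def)
  have "maximalideal N R"
  proof (rule maximalidealI[OF N(1)])
    show "carrier R \<noteq> N" using N(3) by blast
    fix J assume J: "ideal J R" "N \<subseteq> J"
    then show "J = N \<or> J = carrier R"
      using max[of J] N(2) ideal.one_imp_carrier[OF J(1)] by (auto simp: F_def)
  qed
  then show ?thesis
    using unique_maximal N(2) by blast
qed

text \<open>Nakayama's lemma in the form \<open>A \<subseteq> x A\<close> implies \<open>A \<subseteq> 0\<close>. If \<open>b\<close> generates a maximal one among
  the principal ideals of nonzero elements of \<open>A\<close>, then \<open>b = x c\<close> forces \<open>(b) = (c)\<close>,
  so that \<open>c \<in> x (c)\<close>.\<close>

lemma divisible_subset_zero:
  assumes x: "x \<in> M" and A: "A \<subseteq> carrier R" and div: "\<And>a. a \<in> A \<Longrightarrow> \<exists>b\<in>A. a = x \<otimes> b"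
  shows "A \<subseteq> {\<zero>}"
proof (rule ccontr)
  assume "\<not> A \<subseteq> {\<zero>}"
  have xc: "x \<in> carrier R" using x by auto
  define F where "F = (\<lambda>a. PIdl a) ` (A - {\<zero>})"
  obtain P where "P \<in> F" and max: "\<And>J. \<lbrakk>J \<in> F; P \<subseteq> J\<rbrakk> \<Longrightarrow> J = P"
    by (rule exists_maximal_ideal_in[of F])
      (use \<open>\<not> A \<subseteq> {\<zero>}\<close> A in \<open>auto simp: F_def intro: cgenideal_ideal\<close>)
  then obtain b where b: "b \<in> A" "b \<noteq> \<zero>" "P = PIdl b"
    by (auto simp: F_def)
  then obtain c where c: "c \<in> A" "b = x \<otimes> c"
    using div by blast
  have cc: "c \<in> carrier R" using c A by blast
  have "c \<noteq> \<zero>" using b(2) c(2) xc by auto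
  moreover have "PIdl b \<subseteq> PIdl c"
    using c(2) xc cc cgenideal_ideal[OF cc] by (intro cgenideal_minimal) (auto simp: cgenideal_def)
  ultimately have "PIdl c = PIdl b"
    using max[of "PIdl c"] b(3) c(1) by (auto simp: F_def)
  then obtain r where r: "r \<in> carrier R" "c = r \<otimes> b"
    using cgenideal_self[OF cc] unfolding cgenideal_def by blast
  have "(\<one> \<ominus> r \<otimes> x) \<otimes> c = c \<ominus> r \<otimes> (x \<otimes> c)"
    using r(1) xc cc by algebra
  also have "\<dots> = c \<ominus> c"
    by (simp only: c(2)[symmetric] r(2)[symmetric])
  also have "\<dots> = \<zero>"
    using cc by (simp add: a_minus_def r_neg)
  finally have mem: "\<one> \<ominus> r \<otimes> x \<in> colon {\<zero>} c"
    using r xc by (simp add: colon_def)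
  have "ideal (colon {\<zero>} c) R"
    using cc by (intro colon_ideal zeroideal)
  moreover have "\<one> \<notin> colon {\<zero>} c"
    using \<open>c \<noteq> \<zero>\<close> cc by (simp add: colon_def)
  ultimately have "\<one> \<ominus> r \<otimes> x \<in> M"
    using proper_ideal_subset mem by blast
  then have "(\<one> \<ominus> r \<otimes> x) \<oplus> r \<otimes> x \<in> M"
    using x r by (intro ideal_add[OF M.is_ideal] ideal_mult[OF M.is_ideal])
  moreover have "(\<one> \<ominus> r \<otimes> x) \<oplus> r \<otimes> x = \<one>"
    using r(1) xc by algebra
  ultimately show False
    using M.I_notcarr M.one_imp_carrier by simp
qed

text \<open>The torsion ideal \<open>W\<close> of \<open>L = (0 : u x)\<close> is computed by a single power \<open>x\<^sup>N\<close>, by the ascending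
  chain condition; length counting on \<open>W\<close> then gives \<open>L = W + x L\<close>. Hence
  \<open>x\<^sup>N L = x (x\<^sup>N L)\<close> vanishes by Nakayama, which is enough because \<open>(0 : u) \<subseteq> L\<close>.\<close>

lemma annihilator_power_torsion:
  assumes x: "x \<in> M" and rad: "\<And>m. m \<in> M \<Longrightarrow> \<exists>k::nat. m [^] k \<in> PIdl x"
    and u: "u \<in> carrier R" and ann: "colon {\<zero>} u \<subseteq> PIdl x"
  obtains N :: nat where "\<And>a. \<lbrakk>a \<in> carrier R; a \<otimes> u = \<zero>\<rbrakk> \<Longrightarrow> x [^] N \<otimes> a = \<zero>"
proof -
  have xc: "x \<in> carrier R" using x by auto
  define L where "L = colon {\<zero>} (u \<otimes> x)"
  define W where "W n = L \<inter> colon {\<zero>} (x [^] n)" for n :: nat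
  have L: "ideal L R" and Wi: "ideal (W n) R" for n
    using u xc by (auto simp: L_def W_def intro!: i_intersect colon_ideal zeroideal)
  have Lc: "l \<in> carrier R" if "l \<in> L" for l
    using that by (simp add: L_def colon_def)
  obtain V where "V \<in> range W" and Vmax: "\<And>I. \<lbrakk>I \<in> range W; V \<subseteq> I\<rbrakk> \<Longrightarrow> I = V"
    by (rule exists_maximal_ideal_in[of "range W"]) (use Wi in auto)
  from \<open>V \<in> range W\<close> obtain N where "V = W N"
    by (rule rangeE)
  then have max: "W n = W N" if "W N \<subseteq> W n" for n
    using Vmax[of "W n"] that by simp
  have W_iff: "l \<in> W n \<longleftrightarrow> x [^] n \<otimes> l = \<zero>" if "l \<in> L" for l n
    using that Lc[OF that] xc by (simp add: W_def colon_def m_comm)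
  have pow_Suc: "x [^] Suc N \<otimes> l = x \<otimes> (x [^] N \<otimes> l)" "x [^] Suc N \<otimes> l = x [^] N \<otimes> (x \<otimes> l)"
    if "l \<in> L" for l
    using xc Lc[OF that] by (simp_all add: m_assoc m_lcomm)
  have "W N \<subseteq> W (Suc N)"
  proof
    fix w assume w: "w \<in> W N"
    then have wL: "w \<in> L" by (simp add: W_def)
    then show "w \<in> W (Suc N)"
      using w W_iff[OF wL] pow_Suc(1)[OF wL] xc by simp
  qed
  then have stab: "W (Suc N) = W N" by (rule max)
  have div: "l \<in> W N" if "l \<in> L" "x \<otimes> l \<in> W N" for l
  proof -
    have "x \<otimes> l \<in> L" using that(2) by (simp add: W_def)
    then have "x [^] N \<otimes> (x \<otimes> l) = \<zero>"
      using that(2) W_iff by blast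
    then have "x [^] Suc N \<otimes> l = \<zero>"
      using pow_Suc(2)[OF that(1)] by simp
    then show ?thesis
      using W_iff[OF that(1)] stab by blast
  qed
  \<comment> \<open>The hypothesis \<open>(0 : u) \<subseteq> (x)\<close> places \<open>(0 : u)\<close> even inside \<open>x L\<close>.\<close>
  have ker_u: "\<exists>t\<in>L. a = x \<otimes> t" if a: "a \<in> carrier R" "a \<otimes> u = \<zero>" for a
  proof -
    have "a \<in> PIdl x" using a ann by (auto simp: colon_def)
    then obtain t where t: "t \<in> carrier R" "a = t \<otimes> x"
      unfolding cgenideal_def by blast
    then have "t \<otimes> (u \<otimes> x) = \<zero>"
      using a u xc by (simp add: m_ac)
    then show ?thesis
      using t xc by (auto simp: L_def colon_def m_comm)
  qed
  have fl: "finite_length (W N)"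
  proof (rule finite_length_if_nilpotent[OF maximal Wi])
    fix m assume m: "m \<in> M"
    then obtain k :: nat and r where k: "r \<in> carrier R" "m [^] k = r \<otimes> x"
      using rad unfolding cgenideal_def by blast
    have "m [^] (k * N) \<otimes> w = \<zero>" if w: "w \<in> W N" for w
    proof -
      have wL: "w \<in> L" using w by (simp add: W_def)
      have "m [^] (k * N) = (r \<otimes> x) [^] N"
        using m k by (simp add: nat_pow_pow[symmetric])
      then have "m [^] (k * N) \<otimes> w = r [^] N \<otimes> (x [^] N \<otimes> w)"
        using k(1) xc Lc[OF wL] by (simp add: nat_pow_distrib m_assoc)
      then show ?thesis
        using w W_iff[OF wL] k(1) by simp
    qed
    then show "\<exists>k::nat. \<forall>w\<in>W N. m [^] k \<otimes> w = \<zero>" by blast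
  qed
  have Z: "z \<in> W N" if z: "z \<in> carrier R" "z \<otimes> x = \<zero>" for z
  proof -
    have "z \<otimes> (u \<otimes> x) = u \<otimes> (z \<otimes> x)" "x \<otimes> z = z \<otimes> x"
      using z(1) u xc by (simp_all add: m_ac)
    then have "z \<in> L" "x \<otimes> z \<in> W N"
      using z u ideal_zero[OF Wi] by (simp_all add: L_def colon_def)
    then show ?thesis by (rule div)
  qed
  have uL: "(u \<otimes> l) \<otimes> x = \<zero>" if "l \<in> L" for l
    using that Lc[OF that] u xc by (simp add: L_def colon_def m_ac)
  have img: "(\<otimes>) u ` W N = W N \<inter> colon {\<zero>} x"
  proof (rule kernel_eq_image_swap[OF Wi fl xc u])
    show "W N \<inter> colon {\<zero>} u \<subseteq> (\<otimes>) x ` W N"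
    proof
      fix a assume a: "a \<in> W N \<inter> colon {\<zero>} u"
      then obtain t where t: "t \<in> L" "a = x \<otimes> t"
        using ker_u[of a] by (auto simp: colon_def)
      then show "a \<in> (\<otimes>) x ` W N"
        using a div[OF t(1)] by auto
    qed
    show "(\<otimes>) u ` W N \<subseteq> W N \<inter> colon {\<zero>} x"
    proof
      fix z assume "z \<in> (\<otimes>) u ` W N"
      then obtain w where w: "w \<in> L" "z = u \<otimes> w"
        by (auto simp: W_def)
      then have z: "z \<in> carrier R" "z \<otimes> x = \<zero>"
        using uL u Lc by auto
      then show "z \<in> W N \<inter> colon {\<zero>} x"
        using Z[OF z] by (simp add: colon_def)
    qed
  qed
  have step: "\<exists>t\<in>L. x [^] N \<otimes> l = x \<otimes> (x [^] N \<otimes> t)" if l: "l \<in> L" for l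
  proof -
    have "u \<otimes> l \<in> W N \<inter> colon {\<zero>} x"
      using Z[OF _ uL[OF l]] uL[OF l] u Lc[OF l] by (simp add: colon_def)
    then obtain w where w: "w \<in> W N" "u \<otimes> l = u \<otimes> w"
      unfolding img[symmetric] by blast
    have wL: "w \<in> L" using w by (simp add: W_def)
    note car = Lc[OF l] Lc[OF wL]
    have "(l \<ominus> w) \<otimes> u = u \<otimes> l \<ominus> u \<otimes> w"
      using car u by algebra
    also have "\<dots> = \<zero>"
      using w(2) car u by (simp add: a_minus_def r_neg)
    finally obtain t where t: "t \<in> L" "l \<ominus> w = x \<otimes> t"
      using ker_u[of "l \<ominus> w"] car by auto
    have "x [^] N \<otimes> l = x [^] N \<otimes> (l \<ominus> w) \<oplus> x [^] N \<otimes> w"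
      using car nat_pow_closed[OF xc, of N] by algebra
    also have "\<dots> = x [^] N \<otimes> (x \<otimes> t)"
      using w W_iff[OF wL] t xc Lc[OF t(1)] by simp
    also have "\<dots> = x \<otimes> (x [^] N \<otimes> t)"
      using xc Lc[OF t(1)] by (simp add: m_lcomm)
    finally show ?thesis using t(1) by blast
  qed
  have "(\<otimes>) (x [^] N) ` L \<subseteq> {\<zero>}"
    by (rule divisible_subset_zero[OF x]) (use xc Lc step in auto)
  then have kill: "x [^] N \<otimes> l = \<zero>" if "l \<in> L" for l
    using that by blast
  show ?thesis
  proof (rule that)
    fix a assume a: "a \<in> carrier R" "a \<otimes> u = \<zero>"
    then have "a \<otimes> (u \<otimes> x) = \<zero>"
      using u xc by (simp flip: m_assoc)
    then show "x [^] N \<otimes> a = \<zero>"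
      using a by (intro kill) (simp add: L_def colon_def)
  qed
qed

text \<open>Primaryness holds because an element outside \<open>M = radical R I\<close> is a unit.\<close>

lemma primary_to_if_radical:
  assumes I: "ideal I R" and sub: "I \<subseteq> M" and rad: "M \<subseteq> radical R I"
  shows "primary_to R M I"
  unfolding primary_to_def
proof
  have one: "\<one> \<notin> M"
    using M.I_notcarr M.one_imp_carrier by blast
  interpret Mp: primeideal M R
    by (rule maximalideal_prime[OF maximal])
  have "a \<in> M" if "a \<in> carrier R" "a [^] n \<in> M" for a and n :: nat
    using that one by (induction n) (auto dest: Mp.I_prime[rotated 2])
  then show radM: "radical R I = M"
    using rad sub by (auto simp: radical_def)
  show "primaryideal I R"
  proof (intro primaryideal.intro primaryideal_axioms.intro I is_cring)
    show "carrier R \<noteq> I" using sub one by blast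
    fix a b assume ab: "a \<in> carrier R" "b \<in> carrier R" "a \<otimes> b \<in> I"
    have "a \<in> I" if "b \<notin> M"
    proof -
      have "\<one> \<in> PIdl b"
        using proper_ideal_subset[OF cgenideal_ideal] cgenideal_self ab(2) that by blast
      then obtain c where c: "c \<in> carrier R" "\<one> = c \<otimes> b"
        unfolding cgenideal_def by blast
      have "c \<otimes> (a \<otimes> b) = a \<otimes> (c \<otimes> b)"
        using c(1) ab by (simp add: m_ac)
      also have "\<dots> = a"
        using ab by (simp flip: c(2))
      finally show ?thesis
        using ideal_mult[OF I ab(3) c(1)] by simp
    qed
    then show "a \<in> I \<or> b \<in> radical R I"
      using radM by blast
  qed
qed

end

section \<open>Parameters\<close>

lemma no_prime_chain_if_krull_dim_1:
  assumes "krull_dim R = 1" "primeideal P0 R" "primeideal P1 R" "primeideal P2 R"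
    and "P0 \<subset> P1" "P1 \<subset> P2"
  shows False
proof -
  define P where "P i = (if i = 0 then P0 else if i = 1 then P1 else P2)" for i :: nat
  have "(\<forall>i\<le>2. primeideal (P i) R) \<and> (\<forall>i<2. P i \<subset> P (Suc i))"
    using assms by (auto simp: P_def)
  then have "enat 2 \<le> krull_dim R"
    unfolding krull_dim_def by (intro Sup_upper) blast
  then show False
    using assms(1) by (simp add: one_enat_def)
qed

lemma (in cring) annihilator_subset_if_inj:
  assumes car: "x \<in> carrier R" "u \<in> carrier R"
    and inj: "inj_on (quot_mult R (PIdl (u \<otimes> x)) u) (carrier (R Quot (PIdl x)))"
  shows "colon {\<zero>} u \<subseteq> PIdl x"
proof
  fix a assume "a \<in> colon {\<zero>} u"
  then have a: "a \<in> carrier R" "a \<otimes> u = \<zero>"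
    by (auto simp: colon_def)
  interpret X: ideal "PIdl x" R
    by (rule cgenideal_ideal[OF car(1)])
  have "quot_mult R (PIdl (u \<otimes> x)) u (PIdl x +> a) = quot_mult R (PIdl (u \<otimes> x)) u (PIdl x +> \<zero>)"
    using a car by (simp add: quot_mult_PIdl m_comm)
  moreover have "PIdl x +> b \<in> carrier (R Quot (PIdl x))" if "b \<in> carrier R" for b
    using that by (auto simp: FactRing_def A_RCOSETS_def')
  ultimately have "PIdl x +> a = PIdl x +> \<zero>"
    using inj a by (auto dest: inj_onD)
  then show "a \<in> PIdl x"
    using X.a_rcos_self[OF a(1)] a_coset_add_zero X.a_subset by simp
qed

text \<open>If no power of some \<open>m \<in> M\<close> lay in \<open>(y)\<close>, a prime \<open>P\<close> containing \<open>y\<close> and missing the powers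
  of \<open>m\<close> would exist; being properly contained in \<open>M\<close>, it is a minimal prime. A relation
  \<open>s u\<^sup>n = 0\<close> with \<open>s \<notin> P\<close> can be descended to \<open>n = 0\<close>, replacing \<open>s\<close> by multiples \<open>x\<^sup>N s\<close>.\<close>

theorem theorem4p1:
  fixes R (structure) and M :: "'a set" and x y u :: 'a
  assumes "local_ring R M"
    and "noetherian_ring R"
    and "krull_dim R = 1"
    and "parameter R M x"
    and "u \<in> carrier R"
    and "y = u \<otimes> x"
    and "inj_on (quot_mult R (PIdl y) u) (carrier (R Quot (PIdl x)))"
  shows "parameter R M y"
proof -
  interpret local_ring R M by fact
  interpret noetherian_ring R by fact
  interpret noetherian_local_ring R M ..
  note u = \<open>u \<in> carrier R\<close>
  have xM: "x \<in> M" and radx: "radical R (PIdl x) = M"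
    using assms(4) by (auto simp: parameter_def primary_to_def)
  have xc: "x \<in> carrier R" using xM by auto
  have yM: "y \<in> M"
    using xM u by (simp add: assms(6) M.I_l_closed)
  then have yc: "y \<in> carrier R" by auto
  have "\<exists>k::nat. m [^] k \<in> PIdl x" if "m \<in> M" for m
    using that radx by (auto simp: radical_def)
  then obtain N :: nat where N: "\<And>a. \<lbrakk>a \<in> carrier R; a \<otimes> u = \<zero>\<rbrakk> \<Longrightarrow> x [^] N \<otimes> a = \<zero>"
    using annihilator_power_torsion[OF xM _ u]
      annihilator_subset_if_inj[OF xc u assms(7)[unfolded assms(6)]] by blast
  have "M \<subseteq> radical R (PIdl y)"
  proof (rule ccontr)
    assume "\<not> ?thesis"
    then obtain m where m: "m \<in> M" "m \<notin> radical R (PIdl y)" by blast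
    have mc: "m \<in> carrier R" using m by auto
    obtain P where P: "primeideal P R" "PIdl y \<subseteq> P" "P \<inter> range (\<lambda>n::nat. m [^] n) = {}"
    proof (rule exists_prime_avoiding[OF cgenideal_ideal[OF yc]])
      show "PIdl y \<inter> range (\<lambda>n::nat. m [^] n) = {}"
        using m mc by (auto simp: radical_def)
      show "\<one> \<in> range (\<lambda>n::nat. m [^] n)"
        using nat_pow_0 by (metis rangeI)
    qed (use mc in \<open>auto simp: nat_pow_mult\<close>)
    interpret P: primeideal P R by fact
    have one: "\<one> \<notin> P"
      using P.I_notcarr P.one_imp_carrier by blast
    have mP: "m [^] k \<notin> P" for k :: nat
      using P(3) by blast
    have PM: "P \<subset> M"
      using proper_ideal_subset[OF P.is_ideal one] mP[of 1] mc m(1) by auto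
    have xP: "x \<notin> P"
    proof
      assume "x \<in> P"
      then have "PIdl x \<subseteq> P"
        by (intro cgenideal_minimal P.is_ideal)
      moreover obtain k :: nat where "m [^] k \<in> PIdl x"
        using m(1) radx by (auto simp: radical_def)
      ultimately show False using mP by blast
    qed
    have "u \<otimes> x \<in> P"
      using P(2) cgenideal_self[OF yc] assms(6) by blast
    then have uP: "u \<in> P"
      using P.I_prime u xc xP by blast
    have min: "\<not> Q \<subset> P" if "primeideal Q R" for Q
      using no_prime_chain_if_krull_dim_1[OF assms(3) that P(1) maximalideal_prime[OF maximal]] PM
      by blast
    have xNP: "x [^] n \<notin> P" for n :: nat
      by (induction n) (use one xP xc in \<open>auto dest: P.I_prime[rotated 2]\<close>)
    have nonzero: "s \<otimes> u [^] n \<noteq> \<zero>" if "s \<in> carrier R" "s \<notin> P" for s and n :: nat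
      using that
    proof (induction n arbitrary: s)
      case 0
      then show ?case
        using ideal_zero[OF P.is_ideal] by auto
    next
      case (Suc n)
      have "(s \<otimes> u [^] n) \<otimes> u \<noteq> \<zero>"
      proof
        assume "(s \<otimes> u [^] n) \<otimes> u = \<zero>"
        then have "(x [^] N \<otimes> s) \<otimes> u [^] n = \<zero>"
          using N[of "s \<otimes> u [^] n"] Suc.prems u xc by (simp add: m_assoc)
        moreover have "x [^] N \<otimes> s \<notin> P"
          using P.I_prime xNP Suc.prems xc by blast
        ultimately show False
          using Suc.IH[of "x [^] N \<otimes> s"] Suc.prems xc by simp
      qed
      then show ?case
        using Suc.prems u by (simp add: m_assoc)
    qed
    show False
      using minimal_prime_nilpotent[OF P(1) min uP] nonzero by metis
  qed
  then have "primary_to R M (PIdl y)"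
    using yM yc by (intro primary_to_if_radical cgenideal_ideal cgenideal_minimal M.is_ideal)
  then show ?thesis
    using yM by (simp add: parameter_def)
qed

end
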